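(* Let $n\ge1$ and let $T,\alpha,\beta>0$ satisfy $\dfrac{T}{\alpha\beta}=\dfrac14$. Then there are a smooth complex-valued potential $V$ on $\mathbb{R}^n\times[0,T]$ satisfying, for some constant $C$, $$|V(x,t)|\le \frac{C}{1+|x|^2}\quad\text{in }\mathbb{R}^n\times[0,T],$$ and a nonzero smooth function $u\in C^\infty([0,T],\mathcal{S}(\mathbb{R}^n))$ such that $$\partial_t u=i\left(\Delta u+V(x,t)u\right)\quad\text{in }\mathbb{R}^n\times[0,T]$$ and $\|e^{|x|^2/\beta^2}u(0)\|_{L^2(\mathbb{R}^n)}$ and $\|e^{|x|^2/\alpha^2}u(T)\|_{L^2(\mathbb{R}^n)}$ are both finite.
   Context: $\mathcal{S}(\mathbb{R}^n)$ is the Schwartz space of complex-valued functions, $\Delta$ is the Laplacian in $x$, and $u(t)=u(\cdot,t)$. *)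

theory Defs
  imports "HOL-Analysis.Analysis"
begin

(* The set S may contain boundary points: derivatives are taken within S, so they are
   one-sided there. This is intended for sets such as UNIV and UNIV \<times> {0..T} with T > 0,
   on which the derivative within S is unique. *)
primrec Ck_on :: "nat \<Rightarrow> 'a::euclidean_space set \<Rightarrow> ('a \<Rightarrow> 'b::real_normed_vector) \<Rightarrow> bool" where
  "Ck_on 0 S f \<longleftrightarrow> continuous_on S f"
| "Ck_on (Suc k) S f \<longleftrightarrow>
     (\<exists>f'. (\<forall>x\<in>S. (f has_derivative f' x) (at x within S)) \<and> (\<forall>v. Ck_on k S (\<lambda>x. f' x v)))"

definition smooth_on :: "'a::euclidean_space set \<Rightarrow> ('a \<Rightarrow> 'b::real_normed_vector) \<Rightarrow> bool" where
  "smooth_on S f \<longleftrightarrow> (\<forall>k. Ck_on k S f)"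

definition partial_deriv :: "'n::finite \<Rightarrow> (real^'n \<Rightarrow> complex) \<Rightarrow> real^'n \<Rightarrow> complex" where
  "partial_deriv i f x = vector_derivative (\<lambda>h. f (x + h *\<^sub>R axis i 1)) (at 0)"

(* A multi-index is given by a list of coordinate directions; for smooth functions
   the order of the list does not matter. *)
definition partial_derivs :: "'n::finite list \<Rightarrow> (real^'n \<Rightarrow> complex) \<Rightarrow> real^'n \<Rightarrow> complex" where
  "partial_derivs is f = foldr partial_deriv is f"

definition laplacian :: "(real^'n::finite \<Rightarrow> complex) \<Rightarrow> real^'n \<Rightarrow> complex" where
  "laplacian f x = (\<Sum>i\<in>UNIV. partial_derivs [i, i] f x)"

definition schwartz :: "(real^'n::finite \<Rightarrow> complex) \<Rightarrow> bool" where
  "schwartz f \<longleftrightarrow> smooth_on UNIV f \<and>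
     (\<forall>k is. bdd_above (range (\<lambda>x. norm x ^ k * cmod (partial_derivs is f x))))"

(* Only meaningful for Schwartz functions, for which the supremum is over a bounded set. *)
definition schwartz_seminorm :: "nat \<Rightarrow> 'n::finite list \<Rightarrow> (real^'n \<Rightarrow> complex) \<Rightarrow> real" where
  "schwartz_seminorm k is f = (SUP x. norm x ^ k * cmod (partial_derivs is f x))"

(* Differentiability of a curve in the Frechet space of Schwartz functions: the difference
   quotients converge in every seminorm. *)
definition has_schwartz_derivative ::
  "(real \<Rightarrow> real^'n::finite \<Rightarrow> complex) \<Rightarrow> (real^'n \<Rightarrow> complex) \<Rightarrow> real \<Rightarrow> real set \<Rightarrow> bool" where
  "has_schwartz_derivative u v t I \<longleftrightarrow>
     (\<forall>k is. ((\<lambda>s. schwartz_seminorm k is (\<lambda>x. (u s x - u t x) /\<^sub>R (s - t) - v x)) \<longlongrightarrow> 0)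
       (at t within I))"

(* Membership of u in C^infinity(I, S(R^n)); U j is the j-th time derivative. *)
definition smooth_schwartz_curve :: "real set \<Rightarrow> (real \<Rightarrow> real^'n::finite \<Rightarrow> complex) \<Rightarrow> bool" where
  "smooth_schwartz_curve I u \<longleftrightarrow>
     (\<exists>U :: nat \<Rightarrow> real \<Rightarrow> real^'n \<Rightarrow> complex. U 0 = u \<and>
       (\<forall>j. \<forall>t\<in>I. schwartz (U j t) \<and> has_schwartz_derivative (U j) (U (Suc j) t) t I))"

definition in_L2 :: "(real^'n::finite \<Rightarrow> complex) \<Rightarrow> bool" where
  "in_L2 f \<longleftrightarrow> f \<in> borel_measurable lborel \<and> integrable lborel (\<lambda>x. (cmod (f x))\<^sup>2)"

end

theory Submission
  imports Defs "HOL-Probability.Sinc_Integral"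
begin

text \<open>
  Put \<open>z = a + i (t - b)\<close> and let \<open>u = z\<^sup>m (1 + |x|\<^sup>2)^(-k) exp (-|x|\<^sup>2 / (4 z))\<close>, a damped heat
  kernel at complex time. The weight produces the cross term
  \<open>2 k / z - 2 k / (z (1 + |x|\<^sup>2))\<close> in \<open>\<Delta>u / u\<close>, so the choice \<open>m = 2 k - n / 2\<close> cancels
  everything in \<open>(\<partial>\<^sub>z u - \<Delta>u) / u\<close> that does not decay, and what is left is a potential of size
  \<open>O (1 / (1 + |x|\<^sup>2))\<close>. Since \<open>|u|\<close> equals the Gaussian \<open>exp (-a |x|\<^sup>2 / (4 |z|\<^sup>2))\<close> times
  \<open>(1 + |x|\<^sup>2)^(-k)\<close> up to a factor depending on \<open>t\<close>, the weighted \<open>L\<^sup>2\<close> norms at the critical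
  exponent are finite as soon as \<open>4 k > n\<close>. We take \<open>k = 3 n / 4\<close>, for which \<open>m = n\<close> is an
  integer.

  Regularity in the Schwartz topology comes from the fact that all derivatives of \<open>u\<close> are of the form
  \<open>p u\<close> with \<open>p\<close> in the algebra generated by \<open>x\<^sub>i\<close>, \<open>1 / z\<close> and \<open>1 / (1 + |x|\<^sup>2)\<close>.
\<close>

section \<open>Symmetry of second derivatives\<close>

text \<open>The mean value theorem is applied twice: in direction \<open>v\<close> to the increment
  of \<open>f\<close> over \<open>h *\<^sub>R w\<close>, then in direction \<open>w\<close>. The
  second difference is symmetric in \<open>v\<close> and \<open>w\<close>, and this drives the
  symmetry theorem.\<close>

lemma second_difference_mean_value:
  fixes f :: "'a::real_normed_vector \<Rightarrow> real"
  assumes f: "\<And>x. (f has_derivative f' x) (at x)"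
    and fv: "\<And>x. ((\<lambda>y. f' y v) has_derivative fv x) (at x)"
    and "h > 0"
  shows "\<exists>s\<in>{0..h}. \<exists>r\<in>{0..h}.
    f (p + h *\<^sub>R v + h *\<^sub>R w) - f (p + h *\<^sub>R v) - f (p + h *\<^sub>R w) + f p
      = h\<^sup>2 * fv (p + s *\<^sub>R v + r *\<^sub>R w) w"
proof -
  have lin: "f' x (c *\<^sub>R y) = c * f' x y" "fv x (c *\<^sub>R y) = c * fv x y" for x c y
    using f[of x] fv[of x] by (auto dest!: has_derivative_linear simp: linear_scale)
  have "\<exists>s\<in>{0<..<h}. (f (p + h *\<^sub>R v + h *\<^sub>R w) - f (p + h *\<^sub>R v)) -
      (f (p + 0 *\<^sub>R v + h *\<^sub>R w) - f (p + 0 *\<^sub>R v)) =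
      (h - 0) * (f' (p + s *\<^sub>R v + h *\<^sub>R w) v - f' (p + s *\<^sub>R v) v)"
    by (rule mvt_simple[OF \<open>h > 0\<close>])
      (auto intro!: derivative_eq_intros has_derivative_compose[OF _ f]
        simp: lin algebra_simps)
  then obtain s where s: "s \<in> {0<..<h}" "f (p + h *\<^sub>R v + h *\<^sub>R w) - f (p + h *\<^sub>R v) -
      (f (p + h *\<^sub>R w) - f p) = h * (f' (p + s *\<^sub>R v + h *\<^sub>R w) v - f' (p + s *\<^sub>R v) v)"
    by auto
  have deriv: "((\<lambda>r. f' (p + s *\<^sub>R v + r *\<^sub>R w) v) has_derivative
      (\<lambda>d. d * fv (p + s *\<^sub>R v + r *\<^sub>R w) w)) (at r within S)" for r S
  proof -
    have "((\<lambda>r. p + s *\<^sub>R v + r *\<^sub>R w) has_derivative (\<lambda>d. d *\<^sub>R w)) (at r within S)"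
      by (auto intro!: derivative_eq_intros)
    from has_derivative_compose[OF this fv] show ?thesis
      by (simp add: lin)
  qed
  have "\<exists>r\<in>{0<..<h}. f' (p + s *\<^sub>R v + h *\<^sub>R w) v - f' (p + s *\<^sub>R v + 0 *\<^sub>R w) v
      = (h - 0) * fv (p + s *\<^sub>R v + r *\<^sub>R w) w"
    by (rule mvt_simple[OF \<open>h > 0\<close>]) (rule deriv)
  then obtain r where r: "r \<in> {0<..<h}"
    "f' (p + s *\<^sub>R v + h *\<^sub>R w) v - f' (p + s *\<^sub>R v) v = h * fv (p + s *\<^sub>R v + r *\<^sub>R w) w"
    by auto
  show ?thesis
    by (rule bexI[of _ s], rule bexI[of _ r])
      (use s r in \<open>auto simp: power2_eq_square algebra_simps\<close>)
qed

text \<open>Both mixed derivatives, taken at points near \<open>p\<close>, equal the same second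
  difference divided by \<open>h\<^sup>2\<close>. Continuity at \<open>p\<close> then forces the two
  values at \<open>p\<close> to agree.\<close>

lemma second_derivative_symmetric_real:
  fixes f :: "'a::real_normed_vector \<Rightarrow> real"
  assumes f: "\<And>x. (f has_derivative f' x) (at x)"
    and fv: "\<And>x. ((\<lambda>y. f' y v) has_derivative fv x) (at x)"
    and fw: "\<And>x. ((\<lambda>y. f' y w) has_derivative fw x) (at x)"
    and "isCont (\<lambda>x. fv x w) p" and "isCont (\<lambda>x. fw x v) p"
  shows "fv p w = fw p v"
proof (rule ccontr)
  assume ne: "fv p w \<noteq> fw p v"
  define e where "e = \<bar>fv p w - fw p v\<bar> / 2"
  have "e > 0" using ne by (simp add: e_def)
  obtain d1 where d1: "d1 > 0" "\<And>y. dist y p < d1 \<Longrightarrow> dist (fv y w) (fv p w) < e"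
    using assms(4) \<open>e > 0\<close> unfolding continuous_at_eps_delta by metis
  obtain d2 where d2: "d2 > 0" "\<And>y. dist y p < d2 \<Longrightarrow> dist (fw y v) (fw p v) < e"
    using assms(5) \<open>e > 0\<close> unfolding continuous_at_eps_delta by metis
  \<comment> \<open>Small enough that every \<open>p + s *\<^sub>R v + r *\<^sub>R w\<close> with
    \<open>s\<close>, \<open>r\<close> in \<open>{0..h}\<close> lies in both neighbourhoods; the
    summand 1 keeps the denominator positive when \<open>v\<close> and \<open>w\<close>
    vanish.\<close>
  define h where "h = min d1 d2 / (2 * (1 + norm v + norm w))"
  have pos: "1 + norm v + norm w > 0"
    by (simp add: add_pos_nonneg)
  have h: "h > 0" using d1 d2 pos by (simp add: h_def)
  have near: "dist (p + s *\<^sub>R v + r *\<^sub>R w) p < min d1 d2" if "s \<in> {0..h}" "r \<in> {0..h}" for s r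
  proof -
    have "dist (p + s *\<^sub>R v + r *\<^sub>R w) p \<le> norm (s *\<^sub>R v) + norm (r *\<^sub>R w)"
      by (simp add: dist_norm add.assoc) (metis norm_triangle_ineq norm_scaleR)
    also have "\<dots> \<le> h * norm v + h * norm w"
      using that by (intro add_mono) (auto intro: mult_right_mono)
    also have "\<dots> < 2 * (h * (1 + norm v + norm w))"
      using h by (simp add: algebra_simps add_nonneg_pos)
    also have "\<dots> = min d1 d2"
      using pos by (simp add: h_def field_simps)
    finally show ?thesis .
  qed
  obtain s r where 1: "s \<in> {0..h}" "r \<in> {0..h}"
    "f (p + h *\<^sub>R v + h *\<^sub>R w) - f (p + h *\<^sub>R v) - f (p + h *\<^sub>R w) + f p
      = h\<^sup>2 * fv (p + s *\<^sub>R v + r *\<^sub>R w) w"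
    using second_difference_mean_value[OF f fv h, of p w] by blast
  obtain s' r' where 2: "s' \<in> {0..h}" "r' \<in> {0..h}"
    "f (p + h *\<^sub>R w + h *\<^sub>R v) - f (p + h *\<^sub>R w) - f (p + h *\<^sub>R v) + f p
      = h\<^sup>2 * fw (p + s' *\<^sub>R w + r' *\<^sub>R v) v"
    using second_difference_mean_value[OF f fw h, of p v] by blast
  have "h\<^sup>2 * fv (p + s *\<^sub>R v + r *\<^sub>R w) w = h\<^sup>2 * fw (p + s' *\<^sub>R w + r' *\<^sub>R v) v"
    using 1(3) 2(3) by (simp add: algebra_simps)
  hence "fv (p + s *\<^sub>R v + r *\<^sub>R w) w = fw (p + r' *\<^sub>R v + s' *\<^sub>R w) v"
    using h by (simp add: algebra_simps)
  moreover have "dist (fv (p + s *\<^sub>R v + r *\<^sub>R w) w) (fv p w) < e"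
    using near[OF 1(1,2)] by (intro d1) auto
  moreover have "dist (fw (p + r' *\<^sub>R v + s' *\<^sub>R w) v) (fw p v) < e"
    using near[OF 2(2,1)] by (intro d2) auto
  ultimately have "\<bar>fv p w - fw p v\<bar> < 2 * e"
    by (simp add: dist_real_def)
  thus False by (simp add: e_def)
qed

text \<open>Pairing with an arbitrary vector \<open>c\<close> reduces the claim to the real-valued
  case, hence the inner product on the codomain.\<close>

lemma second_derivative_symmetric:
  fixes f :: "'a::real_normed_vector \<Rightarrow> 'b::real_inner"
  assumes f: "\<And>x. (f has_derivative f' x) (at x)"
    and fv: "\<And>x. ((\<lambda>y. f' y v) has_derivative fv x) (at x)"
    and fw: "\<And>x. ((\<lambda>y. f' y w) has_derivative fw x) (at x)"
    and cont: "isCont (\<lambda>x. fv x w) p" "isCont (\<lambda>x. fw x v) p"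
  shows "fv p w = fw p v"
proof -
  have "fv p w \<bullet> c = fw p v \<bullet> c" for c
    by (rule second_derivative_symmetric_real[of "\<lambda>x. f x \<bullet> c" "\<lambda>x h. f' x h \<bullet> c" v
          "\<lambda>x h. fv x h \<bullet> c" w "\<lambda>x h. fw x h \<bullet> c"])
      (auto intro!: has_derivative_inner_left f fv fw continuous_intros cont)
  thus ?thesis
    by (metis inner_commute vector_eq_rdot)
qed

section \<open>Families of functions closed under differentiation\<close>

text \<open>Regularity is stated for a whole family at once, so that smoothness and facts about
  iterated derivatives need no count of the order. The instances are \<open>symbols\<close>,
  \<open>profiles\<close> and their time slices.\<close>

definition deriv_closed :: "('a::euclidean_space \<Rightarrow> 'b::real_normed_vector) set \<Rightarrow> bool" where
  "deriv_closed F \<longleftrightarrow>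
     (\<forall>f\<in>F. \<exists>f'. (\<forall>x. (f has_derivative f' x) (at x)) \<and> (\<forall>v. (\<lambda>x. f' x v) \<in> F))"

lemma smooth_on_deriv_closed:
  assumes F: "deriv_closed F" and f: "f \<in> F"
  shows "smooth_on S f"
proof -
  have "Ck_on k S f" for k
    using f
  proof (induction k arbitrary: f)
    case 0
    then obtain f' where "\<And>x. (f has_derivative f' x) (at x)"
      using F unfolding deriv_closed_def by blast
    thus ?case
      by (auto intro!: continuous_at_imp_continuous_on has_derivative_continuous)
  next
    case (Suc k)
    then obtain f' where f': "\<And>x. (f has_derivative f' x) (at x)" "\<And>v. (\<lambda>x. f' x v) \<in> F"
      using F unfolding deriv_closed_def by blast
    show ?case
      unfolding Ck_on.simps
      by (rule exI[of _ f']) (auto intro: has_derivative_at_withinI f' Suc.IH)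
  qed
  thus ?thesis by (simp add: smooth_on_def)
qed

definition dird :: "'a \<Rightarrow> ('a::euclidean_space \<Rightarrow> 'b::real_normed_vector) \<Rightarrow> 'a \<Rightarrow> 'b" where
  "dird v f = (\<lambda>x. frechet_derivative f (at x) v)"

lemma dird_eqI: "(\<And>x. (f has_derivative f' x) (at x)) \<Longrightarrow> dird v f = (\<lambda>x. f' x v)"
  unfolding dird_def by (metis frechet_derivative_at)

lemma
  assumes F: "deriv_closed F" and f: "f \<in> F"
  shows has_derivative_dird: "(f has_derivative (\<lambda>v. dird v f x)) (at x)"
    and dird_in: "dird v f \<in> F"
proof -
  obtain f' where f': "\<And>x. (f has_derivative f' x) (at x)" "\<And>v. (\<lambda>x. f' x v) \<in> F"
    using F f unfolding deriv_closed_def by blast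
  show "(f has_derivative (\<lambda>v. dird v f x)) (at x)" "dird v f \<in> F"
    using f' by (simp_all add: dird_eqI[OF f'(1)])
qed

lemma dird_scaleR:
  assumes "deriv_closed F" and "f \<in> F"
  shows "dird (c *\<^sub>R v) f x = c *\<^sub>R dird v f x"
  using has_derivative_linear[OF has_derivative_dird[OF assms]] by (rule linear_scale)

text \<open>Second derivatives of a member are again members, hence differentiable and continuous,
  so the symmetry theorem applies.\<close>

lemma dird_commute:
  fixes F :: "('a::euclidean_space \<Rightarrow> 'b::real_inner) set"
  assumes F: "deriv_closed F" and f: "f \<in> F"
  shows "dird v (dird w f) = dird w (dird v f)"
proof
  fix p
  note D = dird_in[OF F f] has_derivative_dird[OF F]
  show "dird v (dird w f) p = dird w (dird v f) p"
    by (rule second_derivative_symmetric[of f "\<lambda>x v. dird v f x" w "\<lambda>x v. dird v (dird w f) x"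
          v "\<lambda>x w. dird w (dird v f) x"])
      (auto intro!: D f has_derivative_continuous[OF D(2)] dird_in[OF F])
qed

section \<open>Space and time derivatives, and smooth curves in the Schwartz space\<close>

text \<open>The space-time counterpart of \<open>partial_derivs\<close>: keeping \<open>t\<close> as
  a variable lets it be commuted with \<open>dt\<close>.\<close>

definition dxs :: "'n::finite list \<Rightarrow> ((real^'n) \<times> real \<Rightarrow> complex) \<Rightarrow> (real^'n) \<times> real \<Rightarrow> complex" where
  "dxs is f = foldr (\<lambda>i. dird (axis i 1, 0)) is f"

abbreviation dt :: "((real^'n::finite) \<times> real \<Rightarrow> complex) \<Rightarrow> (real^'n) \<times> real \<Rightarrow> complex" where
  "dt \<equiv> dird (0, 1)"

lemma partial_deriv_eqI:
  assumes "\<And>x. ((\<lambda>h. f (x + h *\<^sub>R axis i 1)) has_vector_derivative f' x) (at 0)"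
  shows "partial_deriv i f = f'"
  unfolding partial_deriv_def using assms by (blast intro: vector_derivative_at)

context
  fixes F :: "((real^'n::finite) \<times> real \<Rightarrow> complex) set"
  assumes F: "deriv_closed F"
begin

lemma has_vector_derivative_dx:
  assumes "f \<in> F"
  shows "((\<lambda>h. f (x + h *\<^sub>R axis i 1, t)) has_vector_derivative dird (axis i 1, 0) f (x, t)) (at 0)"
proof -
  have "((\<lambda>h. (x + h *\<^sub>R axis i 1, t)) has_derivative (\<lambda>h. h *\<^sub>R (axis i 1, 0))) (at 0)"
    by (auto intro!: derivative_eq_intros)
  from has_derivative_compose[OF this has_derivative_dird[OF F assms]] show ?thesis
    by (simp only: has_vector_derivative_def dird_scaleR[OF F assms] scaleR_zero_left add_0_right)
qed

lemma has_vector_derivative_dt: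
  assumes "f \<in> F"
  shows "((\<lambda>t. f (x, t)) has_vector_derivative dt f (x, t)) (at t within S)"
proof -
  have "((\<lambda>t. (x, t)) has_derivative (\<lambda>h. h *\<^sub>R (0, 1))) (at t within S)"
    by (auto intro!: derivative_eq_intros)
  from has_derivative_compose[OF this has_derivative_dird[OF F assms]] show ?thesis
    by (simp only: has_vector_derivative_def dird_scaleR[OF F assms] scaleR_zero_left add_0_right)
qed

lemma dxs_in: "f \<in> F \<Longrightarrow> dxs is f \<in> F"
  by (induction "is") (auto simp: dxs_def intro: dird_in[OF F])

lemma dt_dxs: "f \<in> F \<Longrightarrow> dt (dxs is f) = dxs is (dt f)"
proof (induction "is")
  case (Cons i "is")
  have "dt (dxs (i # is) f) = dird (axis i 1, 0) (dt (dxs is f))"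
    using dird_commute[OF F dxs_in[OF Cons.prems]] by (simp add: dxs_def)
  thus ?case
    using Cons by (simp add: dxs_def)
qed (simp add: dxs_def)

lemma partial_derivs_slice:
  "f \<in> F \<Longrightarrow> partial_derivs is (\<lambda>x. f (x, t)) = (\<lambda>x. dxs is f (x, t))"
proof (induction "is")
  case (Cons i "is")
  have "partial_deriv i (\<lambda>x. dxs is f (x, t)) = (\<lambda>x. dird (axis i 1, 0) (dxs is f) (x, t))"
    by (intro partial_deriv_eqI has_vector_derivative_dx dxs_in Cons.prems)
  thus ?case
    using Cons by (simp add: partial_derivs_def dxs_def)
qed (simp add: partial_derivs_def dxs_def)

text \<open>\<open>partial_deriv\<close> is linear only on differentiable functions, so the quotient
  is carried through the induction in exactly the form that \<open>has_schwartz_derivative\<close>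
  requires.\<close>

lemma partial_derivs_difference_quotient:
  assumes "f \<in> F" "g \<in> F"
  shows "partial_derivs is (\<lambda>x. (f (x, s) - f (x, t)) /\<^sub>R c - g (x, t)) =
    (\<lambda>x. (dxs is f (x, s) - dxs is f (x, t)) /\<^sub>R c - dxs is g (x, t))"
proof (induction "is")
  case (Cons i "is")
  have "partial_deriv i (\<lambda>x. (dxs is f (x, s) - dxs is f (x, t)) /\<^sub>R c - dxs is g (x, t)) =
    (\<lambda>x. (dird (axis i 1, 0) (dxs is f) (x, s) - dird (axis i 1, 0) (dxs is f) (x, t)) /\<^sub>R c
      - dird (axis i 1, 0) (dxs is g) (x, t))"
    by (intro partial_deriv_eqI has_vector_derivative_diff has_vector_derivative_dx dxs_in assms
        has_vector_derivative_scaleR[where f = "\<lambda>_. inverse c" and f' = 0, simplified])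
  thus ?case
    using Cons by (simp add: partial_derivs_def dxs_def)
qed (simp add: partial_derivs_def dxs_def)

lemma smooth_on_slice: "f \<in> F \<Longrightarrow> smooth_on S (\<lambda>x. f (x, t))"
proof (rule smooth_on_deriv_closed[of "(\<lambda>f x. f (x, t)) ` F"])
  show "deriv_closed ((\<lambda>f x. f (x, t)) ` F)"
    unfolding deriv_closed_def ball_simps
  proof (intro ballI exI conjI allI)
    fix f x v assume f: "f \<in> F"
    show "((\<lambda>x. f (x, t)) has_derivative (\<lambda>v. dird (v, 0) f (x, t))) (at x)"
      by (rule has_derivative_compose[of "\<lambda>x. (x, t)", OF _ has_derivative_dird[OF F f]])
        (auto intro!: derivative_eq_intros)
    show "(\<lambda>x. dird (v, 0) f (x, t)) \<in> (\<lambda>f x. f (x, t)) ` F"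
      by (rule image_eqI[OF refl dird_in[OF F f]])
  qed
qed simp

text \<open>Mean value inequality twice: \<open>dt f\<close> varies by at most
  \<open>M * \<bar>s - t\<bar>\<close> on the segment, which bounds the linearization error of
  \<open>f\<close>. The point \<open>x\<close> is frozen, so \<open>M\<close> may depend on it; the
  sharper constant \<open>M / 2\<close> is not pursued.\<close>

lemma time_taylor:
  assumes f: "f \<in> F" and st: "s \<in> {t0..t1}" "t \<in> {t0..t1}"
    and M: "\<And>r. r \<in> {t0..t1} \<Longrightarrow> norm (dt (dt f) (x, r)) \<le> M"
  shows "norm (f (x, s) - f (x, t) - (s - t) *\<^sub>R dt f (x, t)) \<le> M * (s - t)\<^sup>2"
proof -
  note D = dird_in[OF F f] has_vector_derivative_dt
  have seg: "closed_segment t s \<subseteq> {t0..t1}"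
    using st by (simp add: closed_segment_subset)
  have "M \<ge> 0"
    using M[OF st(1)] norm_ge_zero order_trans by blast
  have "norm (dt f (x, r) - dt f (x, t)) \<le> norm (s - t) * M" if r: "r \<in> closed_segment t s" for r
  proof -
    have "norm (dt f (x, r) - dt f (x, t)) \<le> M * norm (r - t)"
    proof (rule differentiable_bound[where S = "closed_segment t s"
          and f' = "\<lambda>r h. h *\<^sub>R dt (dt f) (x, r)"])
      show "onorm (\<lambda>h. h *\<^sub>R dt (dt f) (x, r)) \<le> M" if "r \<in> closed_segment t s" for r
        using M[of r] that seg
        by (intro onorm_le) (auto simp: mult.commute[of _ "cmod _"] intro!: mult_right_mono)
      show "((\<lambda>r. dt f (x, r)) has_derivative (\<lambda>h. h *\<^sub>R dt (dt f) (x, r)))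
          (at r within closed_segment t s)" for r
        using D(2)[OF D(1)] by (simp only: has_vector_derivative_def)
    qed (use r in simp_all)
    also have "\<dots> \<le> M * norm (s - t)"
      using r \<open>M \<ge> 0\<close> by (intro mult_left_mono) (auto simp: closed_segment_eq_real_ivl split: if_splits)
    finally show ?thesis by (simp add: mult.commute)
  qed
  then have "norm (f (x, s) - f (x, t) - (s - t) *\<^sub>R dt f (x, t)) \<le> norm (s - t) * (norm (s - t) * M)"
    using st
    by (intro vector_differentiable_bound_linearization[where S = "closed_segment t s"] D(2) f) auto
  also have "\<dots> = M * \<bar>s - t\<bar>\<^sup>2"
    by (simp only: power2_eq_square real_norm_def mult_ac)
  finally show ?thesis by (simp only: power2_abs)
qed

text \<open>Since \<open>dt\<close> commutes with \<open>dxs is\<close>, the Taylor estimate for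
  \<open>dxs is f\<close> controls each seminorm of the difference quotient error. Decay of the
  second time derivative, uniform in time, makes that error of order
  \<open>\<bar>s - t\<bar>\<close>.\<close>

lemma smooth_schwartz_curve_slice:
  assumes decay: "\<And>f k. f \<in> F \<Longrightarrow> \<exists>C. \<forall>x. \<forall>t\<in>{t0..t1}. norm x ^ k * norm (f (x, t)) \<le> C"
    and f: "f \<in> F"
  shows "smooth_schwartz_curve {t0..t1} (\<lambda>t x. f (x, t))"
proof -
  have schwartz: "schwartz (\<lambda>x. f (x, t))" if f: "f \<in> F" and t: "t \<in> {t0..t1}" for f t
    unfolding schwartz_def partial_derivs_slice[OF f]
  proof (intro conjI allI smooth_on_slice f)
    fix k :: nat and "is" :: "'n list"
    obtain C where "\<And>x. norm x ^ k * norm (dxs is f (x, t)) \<le> C"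
      using decay[OF dxs_in[OF f]] t by blast
    thus "bdd_above (range (\<lambda>x. norm x ^ k * cmod (dxs is f (x, t))))"
      by (rule bdd_aboveI2)
  qed
  have deriv: "has_schwartz_derivative (\<lambda>t x. f (x, t)) (\<lambda>x. dt f (x, t)) t {t0..t1}"
    if f: "f \<in> F" and t: "t \<in> {t0..t1}" for f t
    unfolding has_schwartz_derivative_def
  proof (intro allI)
    fix k :: nat and "is" :: "'n list"
    define g where "g = dxs is f"
    have g: "g \<in> F" using f by (simp add: g_def dxs_in)
    have dg: "dxs is (dt f) = dt g" using f by (simp add: g_def dt_dxs)
    obtain M where M: "\<And>x r. r \<in> {t0..t1} \<Longrightarrow> norm x ^ k * norm (dt (dt g) (x, r)) \<le> M"
      using decay[OF dird_in[OF F dird_in[OF F g]]] by blast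
    have "((\<lambda>s. M * \<bar>s - t\<bar>) \<longlongrightarrow> M * \<bar>t - t\<bar>) (at t within {t0..t1})"
      by (intro tendsto_intros)
    hence lim: "((\<lambda>s. M * \<bar>s - t\<bar>) \<longlongrightarrow> 0) (at t within {t0..t1})"
      by simp
    let ?q = "\<lambda>s x. (f (x, s) - f (x, t)) /\<^sub>R (s - t) - dt f (x, t)"
    have bound: "norm x ^ k * cmod (partial_derivs is (?q s) x) \<le> M * \<bar>s - t\<bar>"
      if s: "s \<in> {t0..t1}" "s \<noteq> t" for s x
    proof -
      have "norm x ^ k * norm (g (x, s) - g (x, t) - (s - t) *\<^sub>R dt g (x, t)) \<le> M * (s - t)\<^sup>2"
      \<comment> \<open>The decay bound is divided by \<open>norm x ^ k\<close> to bound the second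
        time derivative at this \<open>x\<close>. Where that factor vanishes the left side is 0 and
        only \<open>M \<ge> 0\<close> is needed.\<close>
      proof (cases "norm x ^ k = 0")
        case True
        have "M \<ge> 0" using M[OF t, of x] by (simp add: True)
        thus ?thesis by (simp add: True)
      next
        case False
        hence pos: "norm x ^ k > 0" by (simp only: less_le) simp
        have "norm (g (x, s) - g (x, t) - (s - t) *\<^sub>R dt g (x, t)) \<le> M / norm x ^ k * (s - t)\<^sup>2"
          using M pos by (intro time_taylor[OF g s(1) t]) (simp add: pos_le_divide_eq mult.commute)
        also have "\<dots> = M * (s - t)\<^sup>2 / norm x ^ k"
          by (simp only: times_divide_eq_left)
        finally show ?thesis
          using pos by (simp only: pos_le_divide_eq mult.commute)
      qed
      moreover have "partial_derivs is (?q s) x = (g (x, s) - g (x, t)) /\<^sub>R (s - t) - dt g (x, t)"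
        by (simp only: partial_derivs_difference_quotient[OF f dird_in[OF F f]] dg g_def)
      hence "g (x, s) - g (x, t) - (s - t) *\<^sub>R dt g (x, t) = (s - t) *\<^sub>R partial_derivs is (?q s) x"
        using s(2) by (simp only: scaleR_diff_right) simp
      ultimately have "norm x ^ k * (\<bar>s - t\<bar> * cmod (partial_derivs is (?q s) x)) \<le> M * \<bar>s - t\<bar>\<^sup>2"
        by (simp only: norm_scaleR power2_abs)
      hence "\<bar>s - t\<bar> * (norm x ^ k * cmod (partial_derivs is (?q s) x)) \<le>
          \<bar>s - t\<bar> * (M * \<bar>s - t\<bar>)"
        by (simp only: mult_ac power2_eq_square)
      thus ?thesis
        by (rule mult_left_le_imp_le) (use s(2) in simp)
    qed
    show "((\<lambda>s. schwartz_seminorm k is (?q s)) \<longlongrightarrow> 0) (at t within {t0..t1})"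
    proof (rule tendsto_sandwich[OF _ _ tendsto_const lim])
      have "0 \<le> schwartz_seminorm k is (?q s) \<and> schwartz_seminorm k is (?q s) \<le> M * \<bar>s - t\<bar>"
        if s: "s \<in> {t0..t1}" "s \<noteq> t" for s
      proof
        \<comment> \<open>The supremum dominates the nonnegative value at the origin;
          \<open>bound\<close> supplies the upper bound that makes the supremum meaningful.\<close>
        have "0 \<le> norm (0::real^'n) ^ k * cmod (partial_derivs is (?q s) 0)" by simp
        also have "\<dots> \<le> schwartz_seminorm k is (?q s)"
          unfolding schwartz_seminorm_def
          using bound[OF s] by (intro cSUP_upper bdd_aboveI2) auto
        finally show "0 \<le> schwartz_seminorm k is (?q s)" .
        show "schwartz_seminorm k is (?q s) \<le> M * \<bar>s - t\<bar>"
          unfolding schwartz_seminorm_def using bound[OF s] by (intro cSUP_least) auto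
      qed
      thus "\<forall>\<^sub>F s in at t within {t0..t1}. 0 \<le> schwartz_seminorm k is (?q s)"
        "\<forall>\<^sub>F s in at t within {t0..t1}. schwartz_seminorm k is (?q s) \<le> M * \<bar>s - t\<bar>"
        by (auto simp: eventually_at_filter)
    qed
  qed
  have iter: "(dt ^^ j) f \<in> F" for j
    by (induction j) (auto intro: f dird_in[OF F])
  show ?thesis
    unfolding smooth_schwartz_curve_def
    by (rule exI[of _ "\<lambda>j t x. (dt ^^ j) f (x, t)"])
      (simp add: schwartz[OF iter] deriv[OF iter])
qed

end

section \<open>The weight and elementary growth bounds\<close>

definition weight :: "'a::real_inner \<Rightarrow> real" where
  "weight x = inverse (1 + x \<bullet> x)"

lemma one_plus_inner_pos: "1 + x \<bullet> x > 0" for x :: "'a::real_inner"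
  by (simp add: add_pos_nonneg)

lemma norm_le_one_plus_inner: "norm x \<le> 1 + x \<bullet> x" for x :: "'a::real_inner"
proof (cases "norm x \<le> 1")
  case False
  thus ?thesis
    using self_le_power[of "norm x" 2] by (simp add: power2_norm_eq_inner)
qed (simp add: add_increasing2)

text \<open>\<open>weight_inner\<close> is the identity that later trades each
  \<open>\<bar>x\<bar>\<^sup>2\<close> multiplied by the weight for a bounded term.\<close>

lemma weight_bounds: "0 < weight x" "weight x \<le> 1" and weight_inner: "(x \<bullet> x) * weight x = 1 - weight x"
  using one_plus_inner_pos[of x] by (auto simp: weight_def field_simps)

lemma has_derivative_weight:
  "(weight has_derivative (\<lambda>v. - (2 * (weight x)\<^sup>2 * (x \<bullet> v)))) (at x)"
  unfolding weight_def using one_plus_inner_pos[of x]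
  by (auto intro!: derivative_eq_intros simp: inner_commute power2_eq_square algebra_simps)

lemma power_le_exp:
  fixes c :: real
  assumes "c > 0"
  shows "\<exists>C. \<forall>y\<ge>0. (1 + y) ^ m \<le> C * exp (c * y)"
proof -
  \<comment> \<open>\<open>d \<le> 1\<close> gives
    \<open>d * (1 + y) \<le> 1 + d * y \<le> exp (d * y)\<close>, and the other bound gives
    \<open>real m * d \<le> c\<close> after taking the power \<open>m\<close>. \<open>Suc m\<close>
    avoids division by zero for \<open>m = 0\<close>.\<close>
  define d where "d = min 1 (c / real (Suc m))"
  have d: "d > 0" "d \<le> 1" using assms by (auto simp: d_def)
  have "(1 + y) ^ m \<le> (1 / d) ^ m * exp (c * y)" if y: "y \<ge> 0" for y
  proof -
    have "d * (1 + y) \<le> exp (d * y)"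
      using exp_ge_add_one_self[of "d * y"] d by (simp only: distrib_left mult_1_right)
    hence "(d * (1 + y)) ^ m \<le> exp (d * y) ^ m"
      using d y by (intro power_mono) auto
    also have "\<dots> = exp (real m * (d * y))"
      by (simp add: exp_of_nat_mult)
    also have "\<dots> \<le> exp (c * y)"
    proof -
      have "real m * d \<le> real (Suc m) * (c / real (Suc m))"
        using assms by (intro mult_mono) (auto simp: d_def)
      hence "real m * d \<le> c" by simp
      from mult_right_mono[OF this y] show ?thesis by (simp add: mult.assoc)
    qed
    finally have "(1 / d) ^ m * (d * (1 + y)) ^ m \<le> (1 / d) ^ m * exp (c * y)"
      using d by (intro mult_left_mono) auto
    thus ?thesis
      using d by (simp flip: power_mult_distrib)
  qed
  thus ?thesis by blast
qed

section \<open>Complex time and the algebra of symbols\<close>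

text \<open>\<open>a > 0\<close> keeps complex time away from 0 and makes the Gaussian decay. At
  \<open>t = b\<close> the real part of the inverse time, and with it the decay rate, is
  largest.\<close>

locale complex_time =
  fixes a b :: real
  assumes a_pos: "a > 0"
begin

definition ctime :: "real \<Rightarrow> complex" where
  "ctime t = of_real a + \<i> * of_real (t - b)"

definition ictime :: "real \<Rightarrow> complex" where
  "ictime t = inverse (ctime t)"

lemma ctime_nonzero: "ctime t \<noteq> 0"
  using a_pos by (auto simp: ctime_def complex_eq_iff)

lemma ictime_ctime: "ictime t * ctime t = 1"
  using ctime_nonzero by (simp add: ictime_def)

lemma norm_ictime_le: "cmod (ictime t) \<le> inverse a"
proof -
  have "a \<le> cmod (ctime t)"
    using abs_Re_le_cmod[of "ctime t"] by (simp add: ctime_def)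
  thus ?thesis
    using a_pos by (simp add: ictime_def norm_inverse le_imp_inverse_le)
qed

lemma Re_ictime: "Re (ictime t) = a / (a\<^sup>2 + (t - b)\<^sup>2)"
  by (simp add: ictime_def ctime_def)

lemma has_derivative_ctime: "((\<lambda>p. ctime (snd p)) has_derivative (\<lambda>v. \<i> * of_real (snd v))) (at p)"
  unfolding ctime_def by (auto intro!: derivative_eq_intros)

lemma has_derivative_ictime:
  "((\<lambda>p. ictime (snd p)) has_derivative (\<lambda>v. - (\<i> * of_real (snd v) * (ictime (snd p))\<^sup>2))) (at p)"
  unfolding ictime_def
  by (auto intro!: derivative_eq_intros has_derivative_ctime ctime_nonzero simp: power2_eq_square)

text \<open>The derivatives of the generators are polynomials in the generators: that of
  \<open>ictime\<close> is a multiple of its square, that of \<open>weight\<close> is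
  \<open>weight\<^sup>2\<close> times a linear form in \<open>x\<close>. All generators are bounded
  in \<open>t\<close>.\<close>

inductive_set symbols :: "((real^'n::finite) \<times> real \<Rightarrow> complex) set" where
  const: "(\<lambda>_. c) \<in> symbols"
| coord: "(\<lambda>p. of_real (fst p $ i)) \<in> symbols"
| ictime: "(\<lambda>p. ictime (snd p)) \<in> symbols"
| weight: "(\<lambda>p. of_real (weight (fst p))) \<in> symbols"
| add: "f \<in> symbols \<Longrightarrow> g \<in> symbols \<Longrightarrow> (\<lambda>p. f p + g p) \<in> symbols"
| mult: "f \<in> symbols \<Longrightarrow> g \<in> symbols \<Longrightarrow> (\<lambda>p. f p * g p) \<in> symbols"

lemma symbols_uminus: "f \<in> symbols \<Longrightarrow> (\<lambda>p. - f p) \<in> symbols"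
  using symbols.mult[OF symbols.const[of "-1"]] by fastforce

lemma symbols_diff: "f \<in> symbols \<Longrightarrow> g \<in> symbols \<Longrightarrow> (\<lambda>p. f p - g p) \<in> symbols"
  using symbols.add[OF _ symbols_uminus] by fastforce

lemma symbols_power: "f \<in> symbols \<Longrightarrow> (\<lambda>p. f p ^ k) \<in> symbols"
  by (induction k) (auto intro: symbols.intros)

lemma symbols_sum: "(\<And>i. i \<in> I \<Longrightarrow> f i \<in> symbols) \<Longrightarrow> (\<lambda>p. \<Sum>i\<in>I. f i p) \<in> symbols"
  by (induction I rule: infinite_finite_induct) (auto intro: symbols.intros)

lemma symbols_inner: "(\<lambda>p. of_real (fst p \<bullet> v)) \<in> symbols"
  by (auto simp: inner_vec_def intro!: symbols_sum symbols.intros)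

lemma symbols_inner_self: "(\<lambda>p. of_real (fst p \<bullet> fst p)) \<in> symbols"
  by (auto simp: inner_vec_def intro!: symbols_sum symbols.intros)

lemmas symbols_intros = symbols.const symbols.ictime symbols.weight symbols.add symbols.mult
  symbols_uminus symbols_diff symbols_power symbols_inner symbols_inner_self

lemma deriv_closed_symbols: "deriv_closed symbols"
  unfolding deriv_closed_def
proof
  fix f :: "(real^'n) \<times> real \<Rightarrow> complex" assume "f \<in> symbols"
  thus "\<exists>f'. (\<forall>p. (f has_derivative f' p) (at p)) \<and> (\<forall>v. (\<lambda>p. f' p v) \<in> symbols)"
  proof induction
    case (const c)
    show ?case
      by (rule exI[of _ "\<lambda>p v. 0"]) (auto intro: symbols.const)
  next
    case (coord i)
    have "((\<lambda>p. complex_of_real (fst p $ i)) has_derivative (\<lambda>v. of_real (fst v $ i))) (at p)"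
      for p :: "(real^'n) \<times> real"
      by (auto intro!: derivative_eq_intros bounded_linear.has_derivative[OF bounded_linear_vec_nth])
    thus ?case
      by (intro exI[of _ "\<lambda>p v. of_real (fst v $ i)"]) (auto intro: symbols.const)
  next
    case ictime
    show ?case
      by (rule exI[of _ "\<lambda>p v. - (\<i> * of_real (snd v) * (ictime (snd p))\<^sup>2)"])
        (intro conjI allI has_derivative_ictime symbols_intros)
  next
    case weight
    have "((\<lambda>p. complex_of_real (weight (fst p))) has_derivative
        (\<lambda>v. - (2 * (of_real (weight (fst p)))\<^sup>2 * of_real (fst p \<bullet> fst v)))) (at p)"
      for p :: "(real^'n) \<times> real"
      by (auto intro!: derivative_eq_intros has_derivative_compose[OF _ has_derivative_weight])
    thus ?case
      by (intro exI[of _ "\<lambda>p v. - (2 * (of_real (weight (fst p)))\<^sup>2 * of_real (fst p \<bullet> fst v))"])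
        (auto intro!: symbols_intros)
  next
    case (add f g)
    then obtain f' g' where *: "\<And>p. (f has_derivative f' p) (at p)" "\<And>v. (\<lambda>p. f' p v) \<in> symbols"
      "\<And>p. (g has_derivative g' p) (at p)" "\<And>v. (\<lambda>p. g' p v) \<in> symbols"
      by blast
    show ?case
      by (rule exI[of _ "\<lambda>p v. f' p v + g' p v"]) (auto intro!: has_derivative_add * symbols_intros)
  next
    case (mult f g)
    then obtain f' g' where *: "\<And>p. (f has_derivative f' p) (at p)" "\<And>v. (\<lambda>p. f' p v) \<in> symbols"
      "\<And>p. (g has_derivative g' p) (at p)" "\<And>v. (\<lambda>p. g' p v) \<in> symbols"
      by blast
    show ?case
      by (rule exI[of _ "\<lambda>p v. f p * g' p v + f' p v * g p"])
        (auto intro!: has_derivative_mult * mult symbols_intros)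
  qed
qed

text \<open>Bounds are in powers of \<open>1 + x \<bullet> x\<close>, which is at least 1, so the
  exponent \<open>N + N'\<close> serves for sums as well as products.\<close>

lemma symbols_polynomial_growth:
  "f \<in> symbols \<Longrightarrow> \<exists>C N. C \<ge> 0 \<and> (\<forall>x t. cmod (f (x, t)) \<le> C * (1 + x \<bullet> x) ^ N)"
proof (induction rule: symbols.induct)
  case (const c)
  show ?case
    by (rule exI[of _ "cmod c"], rule exI[of _ 0]) simp
next
  case (coord i)
  have "\<bar>x $ i\<bar> \<le> 1 + x \<bullet> x" for x :: "real^'a"
    using component_le_norm_cart norm_le_one_plus_inner by (rule order_trans)
  thus ?case
    by - (rule exI[of _ 1], rule exI[of _ 1], simp)
next
  case ictime
  show ?case
    using norm_ictime_le a_pos by - (rule exI[of _ "inverse a"], rule exI[of _ 0], simp)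
next
  case weight
  show ?case
    by (rule exI[of _ 1], rule exI[of _ 0]) (simp add: weight_bounds abs_of_pos)
next
  case (add f g)
  then obtain C N C' N' where *: "C \<ge> 0" "\<And>x t. cmod (f (x, t)) \<le> C * (1 + x \<bullet> x) ^ N"
    "C' \<ge> 0" "\<And>x t. cmod (g (x, t)) \<le> C' * (1 + x \<bullet> x) ^ N'" by metis
  have "cmod (f (x, t) + g (x, t)) \<le> (C + C') * (1 + x \<bullet> x) ^ (N + N')" for x t
  proof -
    have "cmod (f (x, t) + g (x, t)) \<le> C * (1 + x \<bullet> x) ^ N + C' * (1 + x \<bullet> x) ^ N'"
      by (intro norm_triangle_le add_mono *)
    also have "\<dots> \<le> C * (1 + x \<bullet> x) ^ (N + N') + C' * (1 + x \<bullet> x) ^ (N + N')"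
      using * by (intro add_mono mult_left_mono power_increasing) auto
    finally show ?thesis by (simp add: algebra_simps)
  qed
  thus ?case
    using * by - (rule exI[of _ "C + C'"], rule exI[of _ "N + N'"], auto)
next
  case (mult f g)
  then obtain C N C' N' where *: "C \<ge> 0" "\<And>x t. cmod (f (x, t)) \<le> C * (1 + x \<bullet> x) ^ N"
    "C' \<ge> 0" "\<And>x t. cmod (g (x, t)) \<le> C' * (1 + x \<bullet> x) ^ N'" by metis
  have "cmod (f (x, t) * g (x, t)) \<le> (C * C') * (1 + x \<bullet> x) ^ (N + N')" for x t
  proof -
    have "cmod (f (x, t) * g (x, t)) \<le> (C * (1 + x \<bullet> x) ^ N) * (C' * (1 + x \<bullet> x) ^ N')"
      unfolding norm_mult using * by (intro mult_mono *) auto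
    thus ?thesis by (simp add: power_add mult_ac)
  qed
  thus ?case
    using * by - (rule exI[of _ "C * C'"], rule exI[of _ "N + N'"], auto)
qed

section \<open>The damped Gaussian profile and its decay\<close>

text \<open>The power of complex time is a natural number, so no branch has to be chosen; the
  fractional power \<open>powr\<close> acts on a positive real base only.\<close>

definition profile :: "(real^'n::finite) \<times> real \<Rightarrow> complex" where
  "profile p = ctime (snd p) ^ CARD('n) *
     (of_real ((1 + fst p \<bullet> fst p) powr (- 3 * CARD('n) / 4)) *
      exp (- (of_real (fst p \<bullet> fst p) * ictime (snd p) / 4)))"

text \<open>The logarithmic derivative of \<open>profile\<close> at \<open>p\<close> in the
  space-time direction \<open>v\<close>. The first line differentiates the weight and the Gaussian
  in \<open>x\<close>; the second collects the power of \<open>ctime\<close> and the Gaussian, with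
  \<open>\<i>\<close> from the time derivative of \<open>ctime\<close>.\<close>

definition log_deriv :: "(real^'n::finite) \<times> real \<Rightarrow> (real^'n) \<times> real \<Rightarrow> complex" where
  "log_deriv v p =
     - (of_real (fst p \<bullet> fst v) * (3 * of_nat CARD('n) / 2 * of_real (weight (fst p)) + ictime (snd p) / 2))
     + \<i> * of_real (snd v) *
        (of_nat CARD('n) * ictime (snd p) + of_real (fst p \<bullet> fst p) * (ictime (snd p))\<^sup>2 / 4)"

lemma log_deriv_symbols: "log_deriv v \<in> symbols"
proof -
  have "(\<lambda>p. log_deriv v p) \<in> symbols"
    unfolding log_deriv_def divide_inverse by (intro symbols_intros)
  thus ?thesis by simp
qed

lemma has_derivative_profile:
  fixes p :: "(real^'n::finite) \<times> real"
  shows "(profile has_derivative (\<lambda>v. log_deriv v p * profile p)) (at p)"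
proof -
  let ?n = "CARD('n)"
  let ?h = "\<lambda>p::(real^'n) \<times> real. (1 + fst p \<bullet> fst p) powr (- 3 * ?n / 4)"
  let ?e = "\<lambda>p::(real^'n) \<times> real. exp (- (of_real (fst p \<bullet> fst p) * ictime (snd p) / 4))"
  let ?w = "weight (fst p)"
  note w = one_plus_inner_pos[of "fst p"]
  \<comment> \<open>The dimension is positive, so \<open>?n - 1\<close> in the power rule is not
    truncated and the power can be written as \<open>ictime\<close> times the full power.\<close>
  obtain m where m: "?n = Suc m"
    using not0_implies_Suc[of ?n] by auto
  have 1: "((\<lambda>p. ctime (snd p) ^ ?n) has_derivative
      (\<lambda>v. \<i> * of_real (snd v) * of_nat ?n * ictime (snd p) * ctime (snd p) ^ ?n)) (at p)"
  proof -
    have "((\<lambda>p. ctime (snd p) ^ ?n) has_derivative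
      (\<lambda>v. of_nat ?n * (\<i> * of_real (snd v)) * ctime (snd p) ^ (?n - 1))) (at p)"
      by (rule has_derivative_power[OF has_derivative_ctime])
    moreover have "ctime (snd p) ^ (?n - 1) = ictime (snd p) * ctime (snd p) ^ ?n"
      using ictime_ctime[of "snd p"] by (simp add: m mult.assoc[symmetric])
    ultimately show ?thesis
      by (simp only: mult_ac)
  qed
  have 2: "((\<lambda>p. complex_of_real (?h p)) has_derivative
      (\<lambda>v. of_real (- (3 * ?n / 2 * ?w * (fst p \<bullet> fst v) * ?h p)))) (at p)"
  proof (rule has_derivative_of_real)
    show "(?h has_derivative (\<lambda>v. - (3 * ?n / 2 * ?w * (fst p \<bullet> fst v) * ?h p))) (at p)"
      by (rule has_derivative_eq_rhs[OF has_derivative_powr])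
        (use w in \<open>auto intro!: derivative_eq_intros simp: weight_def inner_commute field_simps\<close>)
  qed
  have 3: "(?e has_derivative (\<lambda>v. ?e p *
      (- (of_real (fst p \<bullet> fst v) * ictime (snd p) / 2)
       + \<i> * of_real (snd v) * (of_real (fst p \<bullet> fst p) * (ictime (snd p))\<^sup>2 / 4)))) (at p)"
    by (rule has_derivative_eq_rhs[OF has_derivative_compose[OF _ DERIV_exp[THEN has_field_derivative_imp_has_derivative]]])
      (auto intro!: derivative_eq_intros has_derivative_ictime simp: inner_commute field_simps)
  have "((\<lambda>p. ctime (snd p) ^ ?n * (complex_of_real (?h p) * ?e p)) has_derivative
      (\<lambda>v. log_deriv v p * profile p)) (at p)"
    by (rule has_derivative_eq_rhs[OF has_derivative_mult[OF 1 has_derivative_mult[OF 2 3]]])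
      (simp add: fun_eq_iff log_deriv_def profile_def algebra_simps)
  thus ?thesis
    by (simp add: profile_def[abs_def])
qed

text \<open>Multiples of the profile by symbols. Differentiation only changes the symbol, because
  \<open>log_deriv v\<close> is itself a symbol.\<close>

definition profiles :: "((real^'n::finite) \<times> real \<Rightarrow> complex) set" where
  "profiles = (\<lambda>f p. f p * profile p) ` symbols"

lemma has_derivative_times_profile:
  assumes "f \<in> symbols"
  shows "((\<lambda>p. f p * profile p) has_derivative
    (\<lambda>v. (dird v f p + f p * log_deriv v p) * profile p)) (at p)"
  by (rule has_derivative_eq_rhs[OF has_derivative_mult[OF
        has_derivative_dird[OF deriv_closed_symbols assms] has_derivative_profile]])
    (simp add: fun_eq_iff algebra_simps)

lemma deriv_closed_profiles: "deriv_closed profiles"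
  unfolding deriv_closed_def profiles_def ball_simps
proof (intro ballI exI conjI allI)
  fix f :: "(real^'n) \<times> real \<Rightarrow> complex" and p v
  assume f: "f \<in> symbols"
  show "((\<lambda>p. f p * profile p) has_derivative
    (\<lambda>v. (dird v f p + f p * log_deriv v p) * profile p)) (at p)"
    using f by (rule has_derivative_times_profile)
  show "(\<lambda>p. (dird v f p + f p * log_deriv v p) * profile p) \<in> (\<lambda>f p. f p * profile p) ` symbols"
    by (rule image_eqI[OF refl])
      (intro symbols.add symbols.mult f log_deriv_symbols dird_in[OF deriv_closed_symbols f])
qed

lemma profile_in_profiles: "profile \<in> profiles"
  unfolding profiles_def by (rule image_eqI[of _ _ "\<lambda>_. 1"]) (auto intro: symbols.const)

lemma norm_profile:
  fixes x :: "real^'n::finite"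
  shows "cmod (profile (x, t)) = cmod (ctime t) ^ CARD('n) *
    ((1 + x \<bullet> x) powr (- 3 * CARD('n) / 4) * exp (- (x \<bullet> x * (a / (a\<^sup>2 + (t - b)\<^sup>2)) / 4)))"
  by (simp add: profile_def norm_mult norm_power Re_ictime)

lemma norm_profile_le:
  "\<exists>c K. c > 0 \<and> K \<ge> 0 \<and>
    (\<forall>x::real^'n::finite. \<forall>t\<in>{t0..t1}. cmod (profile (x, t)) \<le> K * exp (- (c * (x \<bullet> x))))"
proof -
  \<comment> \<open>\<open>R\<close> bounds \<open>\<bar>t - b\<bar>\<close> on the time interval.
    Then \<open>c\<close> is a lower bound for the decay rate there, and \<open>a + R\<close> an
    upper bound for the modulus of complex time; the weight is estimated by 1.\<close>
  define R where "R = \<bar>t0\<bar> + \<bar>t1\<bar> + \<bar>b\<bar>"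
  define c where "c = a / (a\<^sup>2 + R\<^sup>2) / 4"
  have "a\<^sup>2 > 0" using a_pos by simp
  hence pos: "a\<^sup>2 + r\<^sup>2 > 0" for r by (simp add: add_pos_nonneg)
  have "cmod (profile (x, t)) \<le> (a + R) ^ CARD('n) * exp (- (c * (x \<bullet> x)))"
    if t: "t \<in> {t0..t1}" for x :: "real^'n" and t
  proof -
    have R: "\<bar>t - b\<bar> \<le> R" using t by (auto simp: R_def)
    have "cmod (ctime t) \<le> a + R"
      using norm_triangle_ineq[of "complex_of_real a" "\<i> * of_real (t - b)"] R a_pos
      by (simp add: ctime_def norm_mult del: of_real_diff)
    hence 1: "cmod (ctime t) ^ CARD('n) \<le> (a + R) ^ CARD('n)"
      by (intro power_mono) auto
    have 2: "(1 + x \<bullet> x) powr (- 3 * CARD('n) / 4) \<le> 1"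
      using powr_mono[of "- 3 * CARD('n) / 4" 0 "1 + x \<bullet> x"] one_plus_inner_pos[of x] by simp
    have "(t - b)\<^sup>2 \<le> R\<^sup>2"
      using R by (metis abs_ge_zero power2_abs power_mono)
    hence "a / (a\<^sup>2 + R\<^sup>2) \<le> a / (a\<^sup>2 + (t - b)\<^sup>2)"
      using a_pos pos by (intro divide_left_mono mult_pos_pos) auto
    hence "x \<bullet> x * (a / (a\<^sup>2 + R\<^sup>2)) / 4 \<le> x \<bullet> x * (a / (a\<^sup>2 + (t - b)\<^sup>2)) / 4"
      by (intro mult_left_mono divide_right_mono) auto
    moreover have "c * (x \<bullet> x) = x \<bullet> x * (a / (a\<^sup>2 + R\<^sup>2)) / 4"
      by (simp add: c_def)
    ultimately have "c * (x \<bullet> x) \<le> x \<bullet> x * (a / (a\<^sup>2 + (t - b)\<^sup>2)) / 4"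
      by simp
    hence 3: "exp (- (x \<bullet> x * (a / (a\<^sup>2 + (t - b)\<^sup>2)) / 4)) \<le> exp (- (c * (x \<bullet> x)))"
      by simp
    have "cmod (profile (x, t)) \<le> (a + R) ^ CARD('n) * (1 * exp (- (c * (x \<bullet> x))))"
      unfolding norm_profile using a_pos by (intro mult_mono 1 2 3) (auto simp: R_def)
    thus ?thesis by simp
  qed
  moreover have "c > 0" unfolding c_def by (intro divide_pos_pos a_pos pos) simp
  moreover have "(a + R) ^ CARD('n) \<ge> 0" using a_pos by (simp add: R_def)
  ultimately show ?thesis by blast
qed

text \<open>The polynomial growth of the symbol and the factor \<open>norm x ^ k\<close> are
  absorbed by the Gaussian, uniformly on the time interval.\<close>

lemma profiles_decay:
  fixes f :: "(real^'n::finite) \<times> real \<Rightarrow> complex"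
  assumes "f \<in> profiles"
  shows "\<exists>C. \<forall>x. \<forall>t\<in>{t0..t1}. norm x ^ k * norm (f (x, t)) \<le> C"
proof -
  obtain g where g: "g \<in> symbols" "f = (\<lambda>p. g p * profile p)"
    using assms by (auto simp: profiles_def)
  obtain C N where C: "C \<ge> 0" "\<And>x t. cmod (g (x, t)) \<le> C * (1 + x \<bullet> x) ^ N"
    using symbols_polynomial_growth[OF g(1)] by blast
  obtain c K where K: "c > 0" "K \<ge> 0"
    "\<And>(x::real^'n) t. t \<in> {t0..t1} \<Longrightarrow> cmod (profile (x, t)) \<le> K * exp (- (c * (x \<bullet> x)))"
    using norm_profile_le by blast
  obtain D where D: "\<And>y. y \<ge> 0 \<Longrightarrow> (1 + y) ^ (k + N) \<le> D * exp (c * y)"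
    using power_le_exp[OF K(1)] by blast
  have "norm x ^ k * norm (f (x, t)) \<le> C * K * D" if t: "t \<in> {t0..t1}" for x t
  proof -
    have "norm x ^ k \<le> (1 + x \<bullet> x) ^ k"
      by (intro power_mono norm_le_one_plus_inner) auto
    hence "norm x ^ k * norm (f (x, t)) \<le>
        (1 + x \<bullet> x) ^ k * ((C * (1 + x \<bullet> x) ^ N) * (K * exp (- (c * (x \<bullet> x)))))"
      unfolding g(2) norm_mult using C K t by (intro mult_mono) auto
    also have "\<dots> = C * K * ((1 + x \<bullet> x) ^ (k + N) * exp (- (c * (x \<bullet> x))))"
      by (simp add: power_add)
    also have "\<dots> \<le> C * K * ((D * exp (c * (x \<bullet> x))) * exp (- (c * (x \<bullet> x))))"
      using C K by (intro mult_left_mono mult_right_mono D) auto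
    also have "\<dots> = C * K * D"
      by (simp add: exp_minus)
    finally show ?thesis .
  qed
  thus ?thesis by blast
qed

section \<open>The potential and the evolution equation\<close>

text \<open>The remainder \<open>(\<partial>\<^sub>z u - \<Delta>u) / u\<close>, simplified by
  \<open>weight_inner\<close>. The common factor \<open>weight\<close> carries all the decay; the
  bracket is bounded.\<close>

definition potential :: "(real^'n::finite) \<times> real \<Rightarrow> complex" where
  "potential p = 3 * of_nat CARD('n) / 2 * of_real (weight (fst p)) *
     (ictime (snd p) + of_nat CARD('n)
       - (2 + 3 * of_nat CARD('n) / 2) * (1 - of_real (weight (fst p))))"

lemma potential_symbols: "potential \<in> symbols"
proof -
  have "(\<lambda>p. potential p) \<in> symbols"
    unfolding potential_def divide_inverse by (intro symbols_intros)
  thus ?thesis by simp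
qed

lemma norm_potential_le:
  fixes x :: "real^'n::finite"
  shows "cmod (potential (x, t)) \<le>
    3 * CARD('n) / 2 * (inverse a + CARD('n) + (2 + 3 * CARD('n) / 2)) / (1 + (norm x)\<^sup>2)"
proof -
  let ?n = "CARD('n)"
  have w: "0 < weight x" "weight x \<le> 1" by (rule weight_bounds)+
  have "cmod ((2 + 3 * of_nat ?n / 2) * (1 - complex_of_real (weight x))) =
      (2 + 3 * ?n / 2) * (1 - weight x)"
  proof -
    have "(2 + 3 * of_nat ?n / 2) * (1 - complex_of_real (weight x)) =
        of_real ((2 + 3 * ?n / 2) * (1 - weight x))"
      by simp
    thus ?thesis using w by (simp only: norm_of_real) simp
  qed
  also have "\<dots> \<le> (2 + 3 * ?n / 2) * 1"
    using w by (intro mult_left_mono) auto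
  finally have 1: "cmod ((2 + 3 * of_nat ?n / 2) * (1 - complex_of_real (weight x))) \<le> 2 + 3 * ?n / 2"
    by simp
  have "cmod (ictime t + of_nat ?n - (2 + 3 * of_nat ?n / 2) * (1 - of_real (weight x)))
      \<le> inverse a + ?n + (2 + 3 * ?n / 2)"
    by (intro norm_triangle_le_diff norm_triangle_le add_mono norm_ictime_le 1) simp
  hence "cmod (potential (x, t)) \<le> 3 * ?n / 2 * weight x * (inverse a + ?n + (2 + 3 * ?n / 2))"
    unfolding potential_def norm_mult using w by (intro mult_mono) (auto simp: norm_divide norm_mult)
  also have "\<dots> = 3 * ?n / 2 * (inverse a + ?n + (2 + 3 * ?n / 2)) / (1 + (norm x)\<^sup>2)"
    unfolding weight_def power2_norm_eq_inner divide_inverse by (simp only: mult_ac)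
  finally show ?thesis .
qed

lemma dird_profile: "dird v profile = (\<lambda>p. log_deriv v p * profile p)"
  by (rule dird_eqI[OF has_derivative_profile])

text \<open>The second derivative of the logarithm of the profile along axis \<open>i\<close>. The
  product rule applies to \<open>x $ i\<close> times the radial factor \<open>?g\<close>; the last
  term comes from differentiating the weight.\<close>

lemma dird_log_deriv_axis:
  fixes i :: "'n::finite"
  shows "dird (axis i 1, 0) (log_deriv (axis i 1, 0)) = (\<lambda>p.
    - (3 * of_nat CARD('n) / 2 * of_real (weight (fst p)) + ictime (snd p) / 2)
    + 3 * of_nat CARD('n) * of_real ((fst p $ i)\<^sup>2) * (of_real (weight (fst p)))\<^sup>2)"
proof -
  let ?g = "\<lambda>p. 3 * of_nat CARD('n) / 2 * complex_of_real (weight (fst p)) + ictime (snd p) / 2"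
  have "((\<lambda>p. complex_of_real (weight (fst p))) has_derivative
      (\<lambda>v. of_real (- (2 * (weight (fst p))\<^sup>2 * (fst p \<bullet> fst v))))) (at p)" for p :: "(real^'n) \<times> real"
    by (auto intro!: derivative_eq_intros has_derivative_compose[OF _ has_derivative_weight])
  note g' = has_derivative_add[OF has_derivative_mult_right[OF this]
      has_derivative_divide'[OF has_derivative_ictime has_derivative_const]]
  have x: "((\<lambda>p. complex_of_real (fst p $ i)) has_derivative (\<lambda>v. of_real (fst v $ i))) (at p)"
    for p :: "(real^'n) \<times> real"
    by (auto intro!: derivative_eq_intros bounded_linear.has_derivative[OF bounded_linear_vec_nth])
  have eq: "log_deriv (axis i 1, 0) = (\<lambda>p. - (of_real (fst p $ i) * ?g p))"
    by (simp add: log_deriv_def fun_eq_iff inner_axis)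
  show ?thesis
    unfolding eq
    by (subst dird_eqI[OF has_derivative_minus[OF has_derivative_mult[OF x g']]])
      (simp_all add: fun_eq_iff inner_axis power2_eq_square algebra_simps)
qed

text \<open>Each second derivative is \<open>D l + l\<^sup>2\<close> times the profile, where
  \<open>l\<close> is the logarithmic derivative along an axis. Summing over the axes leaves an
  algebraic identity in \<open>n\<close>, \<open>w\<close>, \<open>r\<close> and
  \<open>z\<close>.\<close>

lemma laplacian_profile:
  fixes x :: "real^'n::finite"
  shows "\<i> * (laplacian (\<lambda>x. profile (x, t)) x + potential (x, t) * profile (x, t)) = dt profile (x, t)"
proof -
  define n where "n = (of_nat CARD('n) :: complex)"
  define w where "w = complex_of_real (weight x)"
  define r where "r = complex_of_real (x \<bullet> x)"
  define z where "z = ictime t"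
  define L where "L = 3 * n / 2 * w + z / 2"
  have rw: "r * w = 1 - w"
    using arg_cong[OF weight_inner[of x], of complex_of_real] by (simp add: r_def w_def)
  have sum_sq: "(\<Sum>i\<in>UNIV. complex_of_real ((x $ i)\<^sup>2)) = r"
    by (simp add: r_def inner_vec_def power2_eq_square)
  have second: "partial_derivs [i, i] (\<lambda>x. profile (x, t)) x =
      (- L + of_real ((x $ i)\<^sup>2) * (3 * n * w\<^sup>2 + L\<^sup>2)) * profile (x, t)" for i
  proof -
    have "partial_derivs [i, i] (\<lambda>x. profile (x, t)) x =
        dird (axis i 1, 0) (dird (axis i 1, 0) profile) (x, t)"
      by (simp add: partial_derivs_slice[OF deriv_closed_profiles profile_in_profiles] dxs_def)
    also have "\<dots> = (dird (axis i 1, 0) (log_deriv (axis i 1, 0)) (x, t) +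
        log_deriv (axis i 1, 0) (x, t) * log_deriv (axis i 1, 0) (x, t)) * profile (x, t)"
      by (simp only: dird_profile dird_eqI[OF has_derivative_times_profile[OF log_deriv_symbols]])
    also have "log_deriv (axis i 1, 0) (x, t) = - (of_real (x $ i) * L)"
      by (simp add: log_deriv_def inner_axis n_def w_def z_def L_def)
    finally show ?thesis
      unfolding dird_log_deriv_axis
      by (simp add: n_def w_def z_def L_def power2_eq_square algebra_simps)
  qed
  have "laplacian (\<lambda>x. profile (x, t)) x = (- (n * L) + r * (3 * n * w\<^sup>2 + L\<^sup>2)) * profile (x, t)"
    unfolding laplacian_def second
    by (simp only: sum_distrib_right[symmetric] sum.distrib sum_sq) (simp add: n_def)
  moreover have "potential (x, t) = 3 * n / 2 * w * (z + n - (2 + 3 * n / 2) * (1 - w))"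
    by (simp add: potential_def n_def w_def z_def)
  moreover have "dt profile (x, t) = \<i> * (n * z + r * z\<^sup>2 / 4) * profile (x, t)"
    by (simp add: dird_profile log_deriv_def n_def z_def r_def)
  moreover have "- (n * L) + r * (3 * n * w\<^sup>2 + L\<^sup>2) +
      3 * n / 2 * w * (z + n - (2 + 3 * n / 2) * (1 - w)) = n * z + r * z\<^sup>2 / 4"
  proof -
    \<comment> \<open>Every \<open>r\<close> except that in \<open>r * z\<^sup>2 / 4\<close> is
      grouped with a \<open>w\<close>, ready for \<open>rw\<close>. The nondecaying part
      \<open>3 / 2 * n * z\<close> of the cross term and \<open>- n * z / 2\<close> from the first
      term then add up to \<open>n * z\<close>.\<close>
    have "r * (3 * n * w\<^sup>2 + L\<^sup>2) = 3 * n * w * (r * w) + 9 / 4 * n\<^sup>2 * w * (r * w)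
        + 3 / 2 * n * z * (r * w) + r * z\<^sup>2 / 4"
      by (simp add: L_def power2_eq_square algebra_simps)
    thus ?thesis
      unfolding rw by (simp add: L_def power2_eq_square field_simps)
  qed
  ultimately show ?thesis
    by (metis (no_types, lifting) distrib_right mult.assoc)
qed

end

section \<open>Square integrability at the critical exponent\<close>

text \<open>Tonelli's theorem splits the integral into one-dimensional integrals of
  \<open>1 / (1 + x\<^sup>2)\<close>. The product serves as majorant for the radial weight.\<close>

lemma integrable_prod_inverse:
  "integrable lborel (\<lambda>x::'a::euclidean_space. \<Prod>b\<in>Basis. inverse (1 + (x \<bullet> b)\<^sup>2))"
proof (rule integrableI_nonneg)
  have "integrable lborel (\<lambda>x::real. inverse (1 + x\<^sup>2))"
    using integrable_inverse_1_plus_square by (simp add: set_integrable_def)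
  hence fin: "(\<integral>\<^sup>+(x::real). ennreal (inverse (1 + x\<^sup>2)) \<partial>lborel) < \<infinity>"
    by (subst nn_integral_eq_integral) auto
  have "(\<integral>\<^sup>+(x::'a). ennreal (\<Prod>b\<in>Basis. inverse (1 + (x \<bullet> b)\<^sup>2)) \<partial>lborel) =
      (\<integral>\<^sup>+(x::'a). (\<Prod>b\<in>Basis. ennreal (inverse (1 + (x \<bullet> b)\<^sup>2))) \<partial>lborel)"
    by (simp add: prod_ennreal)
  also have "\<dots> = (\<Prod>b\<in>(Basis::'a set). \<integral>\<^sup>+(x::real). ennreal (inverse (1 + x\<^sup>2)) \<partial>lborel)"
    by (rule nn_integral_lborel_prod) auto
  also have "\<dots> < \<infinity>"
    using fin by (simp add: power_less_top_ennreal)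
  finally show "(\<integral>\<^sup>+(x::'a). ennreal (\<Prod>b\<in>Basis. inverse (1 + (x \<bullet> b)\<^sup>2)) \<partial>lborel) < \<infinity>" .
qed (auto intro!: prod_nonneg)

text \<open>Each factor \<open>1 + (x \<bullet> b)\<^sup>2\<close> is at most
  \<open>1 + x \<bullet> x\<close>, so the product of all of them is at most the power with exponent
  the dimension. The range of \<open>s\<close> covers the exponent \<open>3 * n / 2\<close> that
  occurs below.\<close>

lemma integrable_japanese_bracket:
  fixes s :: real
  assumes "s \<ge> DIM('a::euclidean_space)"
  shows "integrable lborel (\<lambda>x::'a. (1 + x \<bullet> x) powr - s)"
proof (rule Bochner_Integration.integrable_bound[OF integrable_prod_inverse])
  have "norm ((1 + x \<bullet> x) powr - s) \<le> norm (\<Prod>b\<in>Basis. inverse (1 + (x \<bullet> b)\<^sup>2))" for x :: 'a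
  proof -
    have pos: "1 + x \<bullet> x > 0" by (rule one_plus_inner_pos)
    have "(\<Prod>b\<in>Basis. 1 + (x \<bullet> b)\<^sup>2) \<le> (\<Prod>b\<in>(Basis::'a set). 1 + x \<bullet> x)"
    proof (intro prod_mono conjI add_left_mono)
      fix b :: 'a assume "b \<in> Basis"
      hence "\<bar>x \<bullet> b\<bar> \<le> norm x" by (rule Basis_le_norm)
      thus "(x \<bullet> b)\<^sup>2 \<le> x \<bullet> x"
        using power_mono[of "\<bar>x \<bullet> b\<bar>" "norm x" 2] by (simp add: power2_norm_eq_inner)
    qed simp
    hence le: "(\<Prod>b\<in>Basis. 1 + (x \<bullet> b)\<^sup>2) \<le> (1 + x \<bullet> x) ^ DIM('a)" by simp
    have "(1 + x \<bullet> x) powr - s \<le> (1 + x \<bullet> x) powr - real DIM('a)"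
      using assms pos by (intro powr_mono) auto
    also have "\<dots> = inverse ((1 + x \<bullet> x) ^ DIM('a))"
      using pos by (simp add: powr_minus powr_realpow)
    also have "\<dots> \<le> inverse (\<Prod>b\<in>Basis. 1 + (x \<bullet> b)\<^sup>2)"
      by (intro le_imp_inverse_le le prod_pos) (auto intro: add_pos_nonneg)
    also have "\<dots> = (\<Prod>b\<in>Basis. inverse (1 + (x \<bullet> b)\<^sup>2))"
      by (simp add: prod_inversef[symmetric] o_def)
    finally show ?thesis
      by (simp add: prod_nonneg)
  qed
  thus "AE x::'a in lborel. norm ((1 + x \<bullet> x) powr - s) \<le> norm (\<Prod>b\<in>Basis. inverse (1 + (x \<bullet> b)\<^sup>2))"
    by simp
qed simp

context complex_time
begin

text \<open>The second assumption says that the Gaussian rate of the profile at time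
  \<open>t\<close> is exactly \<open>1 / \<gamma>\<^sup>2\<close>, so the exponential weight cancels
  it. What remains is a constant times \<open>(1 + x \<bullet> x) powr (- 3 * n / 4)\<close>, whose
  square has exponent \<open>3 * n / 2\<close>, at least the dimension.\<close>

lemma in_L2_profile:
  assumes "\<gamma> > 0" and "a\<^sup>2 + (t - b)\<^sup>2 = a * \<gamma>\<^sup>2 / 4"
  shows "in_L2 (\<lambda>x::real^'n::finite. exp ((norm x)\<^sup>2 / \<gamma>\<^sup>2) * profile (x, t))"
proof -
  let ?n = "CARD('n)"
  have rate: "a / (a\<^sup>2 + (t - b)\<^sup>2) / 4 = 1 / \<gamma>\<^sup>2"
    using a_pos assms by simp
  have norm: "cmod (exp ((norm x)\<^sup>2 / \<gamma>\<^sup>2) * profile (x, t)) =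
      cmod (ctime t) ^ ?n * (1 + x \<bullet> x) powr (- 3 * ?n / 4)" for x :: "real^'n"
  proof -
    have "x \<bullet> x * (a / (a\<^sup>2 + (t - b)\<^sup>2)) / 4 = (norm x)\<^sup>2 / \<gamma>\<^sup>2"
      using rate by (simp add: power2_norm_eq_inner) (metis times_divide_eq_right mult.right_neutral)
    thus ?thesis
      by (simp add: norm_mult norm_profile exp_minus field_simps)
  qed
  have "(cmod (exp ((norm x)\<^sup>2 / \<gamma>\<^sup>2) * profile (x, t)))\<^sup>2 =
      (cmod (ctime t) ^ ?n)\<^sup>2 * (1 + x \<bullet> x) powr - (3 * ?n / 2)" for x :: "real^'n"
    unfolding norm power_mult_distrib by (simp add: power2_eq_square flip: powr_add)
  moreover have "integrable lborel (\<lambda>x::real^'n. (cmod (ctime t) ^ ?n)\<^sup>2 * (1 + x \<bullet> x) powr - (3 * ?n / 2))"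
    by (intro integrable_mult_right integrable_japanese_bracket) simp
  moreover have "continuous_on UNIV (\<lambda>x::real^'n. profile (x, t))"
    using smooth_on_slice[OF deriv_closed_profiles profile_in_profiles, of UNIV t]
    unfolding smooth_on_def by (metis Ck_on.simps(1))
  hence "(\<lambda>x::real^'n. exp ((norm x)\<^sup>2 / \<gamma>\<^sup>2) * profile (x, t)) \<in> borel_measurable lborel"
    using assms by (auto intro!: borel_measurable_continuous_onI continuous_intros)
  ultimately show ?thesis
    by (simp add: in_L2_def)
qed

end

section \<open>Choice of the parameters and conclusion\<close>

theorem theorem2:
  fixes T \<alpha> \<beta> :: real
  assumes "T > 0" and "\<alpha> > 0" and "\<beta> > 0"
    and "T / (\<alpha> * \<beta>) = 1 / 4"
  shows "\<exists>(V :: real^'n::finite \<Rightarrow> real \<Rightarrow> complex) (u :: real \<Rightarrow> real^'n \<Rightarrow> complex).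
    smooth_on (UNIV \<times> {0..T}) (\<lambda>(x, t). V x t) \<and>
    (\<exists>C. \<forall>x. \<forall>t\<in>{0..T}. cmod (V x t) \<le> C / (1 + (norm x)\<^sup>2)) \<and>
    smooth_schwartz_curve {0..T} u \<and>
    (\<exists>t\<in>{0..T}. \<exists>x. u t x \<noteq> 0) \<and>
    (\<forall>x. \<forall>t\<in>{0..T}. ((\<lambda>s. u s x) has_vector_derivative
        \<i> * (laplacian (u t) x + V x t * u t x)) (at t within {0..T})) \<and>
    in_L2 (\<lambda>x. exp ((norm x)\<^sup>2 / \<beta>\<^sup>2) * u 0 x) \<and>
    in_L2 (\<lambda>x. exp ((norm x)\<^sup>2 / \<alpha>\<^sup>2) * u T x)"
proof -
  define d where "d = \<alpha>\<^sup>2 + \<beta>\<^sup>2"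
  have d: "d > 0" using assms by (simp add: d_def add_pos_pos)
  have T: "T = \<alpha> * \<beta> / 4" using assms by (simp add: field_simps)
  \<comment> \<open>The unique solution of the two equations \<open>ends\<close> below, which say that the Gaussian factor of the
    profile is \<open>exp (-|x|\<^sup>2 / \<beta>\<^sup>2)\<close> at time 0 and \<open>exp (-|x|\<^sup>2 / \<alpha>\<^sup>2)\<close> at time \<open>T\<close>.\<close>
  define a where "a = \<alpha>\<^sup>2 * \<beta>\<^sup>2 / (4 * d)"
  define b where "b = \<alpha> * \<beta> ^ 3 / (4 * d)"
  interpret complex_time a b
    by standard (use assms d in \<open>simp add: a_def\<close>)
  \<comment> \<open>This is \<open>b\<close> with \<alpha> and \<beta> exchanged; the relation
    \<open>T = \<alpha> * \<beta> / 4\<close> enters here.\<close>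
  have b': "T - b = \<alpha> ^ 3 * \<beta> / (4 * d)"
    using d by (simp add: T b_def field_simps) (simp add: d_def algebra_simps power2_eq_square power3_eq_cube)
  have ends: "a\<^sup>2 + (0 - b)\<^sup>2 = a * \<beta>\<^sup>2 / 4" "a\<^sup>2 + (T - b)\<^sup>2 = a * \<alpha>\<^sup>2 / 4"
  proof -
    \<comment> \<open>The sum \<open>\<alpha>\<^sup>2 + \<beta>\<^sup>2\<close> is kept as a factor
      so that it folds to \<open>d\<close> and cancels one power in the denominator.\<close>
    have "a\<^sup>2 + (0 - b)\<^sup>2 = \<alpha>\<^sup>2 * \<beta> ^ 4 * (\<alpha>\<^sup>2 + \<beta>\<^sup>2) / (16 * d\<^sup>2)"
      using d by (simp add: a_def b_def field_simps power2_eq_square power3_eq_cube power4_eq_xxxx)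
    thus "a\<^sup>2 + (0 - b)\<^sup>2 = a * \<beta>\<^sup>2 / 4"
      unfolding d_def[symmetric] using d by (simp add: a_def power2_eq_square power4_eq_xxxx)
    have "a\<^sup>2 + (T - b)\<^sup>2 = \<alpha> ^ 4 * \<beta>\<^sup>2 * (\<alpha>\<^sup>2 + \<beta>\<^sup>2) / (16 * d\<^sup>2)"
      unfolding b' using d
      by (simp add: a_def field_simps power2_eq_square power3_eq_cube power4_eq_xxxx)
    thus "a\<^sup>2 + (T - b)\<^sup>2 = a * \<alpha>\<^sup>2 / 4"
      unfolding d_def[symmetric] using d by (simp add: a_def power2_eq_square power4_eq_xxxx)
  qed
  define V :: "real^'n \<Rightarrow> real \<Rightarrow> complex" where "V = (\<lambda>x t. potential (x, t))"
  define u :: "real \<Rightarrow> real^'n \<Rightarrow> complex" where "u = (\<lambda>t x. profile (x, t))"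
  have "smooth_on (UNIV \<times> {0..T}) (\<lambda>(x, t). V x t)"
    using smooth_on_deriv_closed[OF deriv_closed_symbols potential_symbols]
    by (simp add: V_def case_prod_beta)
  moreover have "\<exists>C. \<forall>x. \<forall>t\<in>{0..T}. cmod (V x t) \<le> C / (1 + (norm x)\<^sup>2)"
    using norm_potential_le unfolding V_def by blast
  moreover have "smooth_schwartz_curve {0..T} u"
    unfolding u_def
    by (rule smooth_schwartz_curve_slice[OF deriv_closed_profiles profiles_decay profile_in_profiles])
  moreover have "\<exists>t\<in>{0..T}. \<exists>x. u t x \<noteq> 0"
    \<comment> \<open>At the origin the weight and the exponential are both 1, leaving a power of
      the nonzero complex time.\<close>
    by (rule bexI[of _ 0], rule exI[of _ 0])
      (use assms ctime_nonzero in \<open>auto simp: u_def profile_def\<close>)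
  moreover have "((\<lambda>s. u s x) has_vector_derivative
      \<i> * (laplacian (u t) x + V x t * u t x)) (at t within {0..T})" for x t
    unfolding u_def V_def laplacian_profile
    by (rule has_vector_derivative_dt[OF deriv_closed_profiles profile_in_profiles])
  moreover have "in_L2 (\<lambda>x. exp ((norm x)\<^sup>2 / \<beta>\<^sup>2) * u 0 x)"
    unfolding u_def by (rule in_L2_profile) (use assms ends in auto)
  moreover have "in_L2 (\<lambda>x. exp ((norm x)\<^sup>2 / \<alpha>\<^sup>2) * u T x)"
    unfolding u_def by (rule in_L2_profile) (use assms ends in auto)
  ultimately show ?thesis by blast
qed

end
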